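(* Let $\phi:\mathbb R\to[0,+\infty)$ be a finite-valued Orlicz function with $ces_\phi\neq\{0\}$. If $\phi\in\Delta_2(0)$, then $ces_\phi$ is uniformly monotone.
   Context: A finite-valued map $\phi:\mathbb R\to[0,+\infty)$ is an Orlicz function if it is even, convex, $\phi(0)=0$ and $\phi(u)\to\infty$ as $u\to\infty$ (it is then automatically continuous). One writes $\phi\in\Delta_2(0)$ if there are $K>0$ and $a>0$ such that $\phi(a)>0$ and $\phi(2u)\le K\phi(u)$ for all $u\in[0,a]$. Let $l^0$ be the space of all real sequences $x=(x(i))_{i=1}^\infty$. For $x\in l^0$ put $\sigma x(i)=\frac1i\sum_{j=1}^i|x(j)|$ and $\rho_\phi(x)=\sum_{i=1}^\infty\phi(\sigma x(i))$. The Cesàro–Orlicz sequence space is $ces_\phi=\{x\in l^0:\ \rho_\phi(\lambda x)<\infty\text{ for some }\lambda>0\}$, equipped with the Luxemburg norm $\|x\|_\phi=\inf\{\lambda>0:\rho_\phi(x/\lambda)\le1\}$. A normed sequence space $X\subset l^0$ is uniformly monotone if for each $\epsilon>0$ there exists $\delta(\epsilon)>0$ such that for any $x,y\in X$ with $x,y\ge0$ (coordinatewise), $\|x\|=1$ and $\|y\|\ge\epsilon$, we have $\|x+y\|\ge1+\delta(\epsilon)$. *)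

theory Defs
  imports "HOL-Analysis.Analysis"
begin

definition orlicz_function :: "(real \<Rightarrow> real) \<Rightarrow> bool" where
  "orlicz_function \<phi> \<longleftrightarrow>
     (\<forall>u. 0 \<le> \<phi> u) \<and> (\<forall>u. \<phi> (- u) = \<phi> u) \<and> convex_on UNIV \<phi> \<and> \<phi> 0 = 0 \<and>
     filterlim \<phi> at_top at_top"

definition delta2_at_0 :: "(real \<Rightarrow> real) \<Rightarrow> bool" where
  "delta2_at_0 \<phi> \<longleftrightarrow>
     (\<exists>K>0. \<exists>a>0. \<phi> a > 0 \<and> (\<forall>u\<in>{0..a}. \<phi> (2 * u) \<le> K * \<phi> u))"

(* Real sequences are functions on nat, indexed from 0: the entry x i stands for x(i+1)
   of the usual 1-based notation. Hence the divisor Suc i and the sum over j \<le> i. *)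

definition cesaro_mean :: "(nat \<Rightarrow> real) \<Rightarrow> nat \<Rightarrow> real" where
  "cesaro_mean x i = (\<Sum>j\<le>i. \<bar>x j\<bar>) / real (Suc i)"

(* Valued in ennreal, so that divergence of the series is the value \<infinity>. *)
definition ces_modular :: "(real \<Rightarrow> real) \<Rightarrow> (nat \<Rightarrow> real) \<Rightarrow> ennreal" where
  "ces_modular \<phi> x = (\<Sum>i. ennreal (\<phi> (cesaro_mean x i)))"

definition ces_space :: "(real \<Rightarrow> real) \<Rightarrow> (nat \<Rightarrow> real) set" where
  "ces_space \<phi> = {x. \<exists>l>0. ces_modular \<phi> (\<lambda>i. l * x i) < \<infinity>}"

(* For an Orlicz function and x in ces_space, the set below is nonempty and bounded below
   by 0, so the real Inf is the genuine infimum; outside ces_space the value is irrelevant. *)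
definition luxemburg_norm :: "(real \<Rightarrow> real) \<Rightarrow> (nat \<Rightarrow> real) \<Rightarrow> real" where
  "luxemburg_norm \<phi> x = Inf {l. l > 0 \<and> ces_modular \<phi> (\<lambda>i. x i / l) \<le> 1}"

(* A normed sequence space is given by its carrier X and its norm N on X. *)
definition uniformly_monotone ::
    "(nat \<Rightarrow> real) set \<Rightarrow> ((nat \<Rightarrow> real) \<Rightarrow> real) \<Rightarrow> bool" where
  "uniformly_monotone X N \<longleftrightarrow>
     (\<forall>\<epsilon>>0. \<exists>\<delta>>0. \<forall>x\<in>X. \<forall>y\<in>X.
        (\<forall>i. 0 \<le> x i) \<longrightarrow> (\<forall>i. 0 \<le> y i) \<longrightarrow> N x = 1 \<longrightarrow> N y \<ge> \<epsilon> \<longrightarrow>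
        N (\<lambda>i. x i + y i) \<ge> 1 + \<delta>)"

end

theory Submission
  imports Defs
begin

text \<open>
  Since \<phi> is superadditive on the nonnegative reals and Cesaro means of nonnegative sequences
  are additive, \<rho>(x + y) \<ge> \<rho>(x) + \<rho>(y). The doubling condition at 0 extends to every interval [0, M], and
  \<rho>(x) \<le> 1 confines the Cesaro means of x to such an interval; hence on the unit ball of the modular
  \<rho>(c x) is bounded by a multiple of \<rho>(x), with a factor 1 + O(t) when c = 1 + t. This yields
  \<rho>(x) \<ge> 1 if the norm of x is 1, a uniform bound \<rho>(y) \<ge> \<eta> if the norm of y is at least \<epsilon>,
  and turns \<rho>(x + y) \<ge> 1 + \<eta> into a norm bound for x + y.
\<close>

section \<open>Cesaro means and an upper bound for the norm\<close>

lemma cesaro_mean_nonneg: "0 \<le> cesaro_mean x i"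
  by (simp add: cesaro_mean_def sum_nonneg)

lemma cesaro_mean_scale: "cesaro_mean (\<lambda>i. c * x i) i = \<bar>c\<bar> * cesaro_mean x i"
  by (simp add: cesaro_mean_def abs_mult sum_distrib_left)

lemma cesaro_mean_add:
  assumes "\<And>i. 0 \<le> x i" "\<And>i. 0 \<le> y i"
  shows "cesaro_mean (\<lambda>i. x i + y i) i = cesaro_mean x i + cesaro_mean y i"
  using assms by (simp add: cesaro_mean_def sum.distrib add_divide_distrib)

lemma luxemburg_norm_le:
  assumes "0 < l" "ces_modular \<phi> (\<lambda>i. x i / l) \<le> 1"
  shows "luxemburg_norm \<phi> x \<le> l"
  unfolding luxemburg_norm_def
  by (rule cInf_lower) (use assms in \<open>auto intro!: bdd_belowI[of _ 0]\<close>)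

section \<open>Inequalities for Orlicz functions\<close>

context
  fixes \<phi> :: "real \<Rightarrow> real"
  assumes orlicz: "orlicz_function \<phi>"
begin

lemma orlicz_nonneg: "0 \<le> \<phi> u"
  and orlicz_zero: "\<phi> 0 = 0"
  and orlicz_convex: "convex_on UNIV \<phi>"
  and orlicz_at_top: "filterlim \<phi> at_top at_top"
  using orlicz by (auto simp: orlicz_function_def)

lemma orlicz_scale_le:
  assumes "0 \<le> t" "t \<le> 1"
  shows "\<phi> (t * u) \<le> t * \<phi> u"
  using convex_onD[OF orlicz_convex, of t 0 u] assms by (simp add: orlicz_zero)

lemma orlicz_mono:
  assumes "0 \<le> u" "u \<le> v"
  shows "\<phi> u \<le> \<phi> v"
proof (cases "v = 0")
  case False
  then have "v > 0" using assms by simp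
  then have "\<phi> (u / v * v) \<le> u / v * \<phi> v"
    using assms by (intro orlicz_scale_le) auto
  also have "\<dots> \<le> 1 * \<phi> v"
    using assms \<open>v > 0\<close> by (intro mult_right_mono orlicz_nonneg) auto
  finally show ?thesis using \<open>v > 0\<close> by simp
qed (use assms in simp)

text \<open>Convexity and \<phi>(0) = 0 put \<phi> below the chord from 0 to u + v. Reading this
  chord at u and at v gives two weights that sum to 1.\<close>

lemma orlicz_superadditive:
  assumes "0 \<le> u" "0 \<le> v"
  shows "\<phi> u + \<phi> v \<le> \<phi> (u + v)"
proof (cases "u + v = 0")
  case True
  then have "u = 0" "v = 0" using assms by auto
  then show ?thesis by (simp add: orlicz_zero)
next
  case False
  then have s: "u + v > 0" using assms by simp
  have "\<phi> w \<le> w / (u + v) * \<phi> (u + v)" if "0 \<le> w" "w \<le> u + v" for w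
    using orlicz_scale_le[of "w / (u + v)" "u + v"] that s by simp
  from this[of u] this[of v]
  have "\<phi> u + \<phi> v \<le> u / (u + v) * \<phi> (u + v) + v / (u + v) * \<phi> (u + v)"
    using assms by simp
  also have "\<dots> = (u / (u + v) + v / (u + v)) * \<phi> (u + v)"
    by (simp only: distrib_right)
  also have "u / (u + v) + v / (u + v) = 1"
    using s by (simp add: add_divide_distrib[symmetric])
  finally show ?thesis by simp
qed

text \<open>The sum is at most twice the larger summand. The price is a doubled argument, which
  \<open>ces_space_add\<close> pays by halving its scaling factor.\<close>

lemma orlicz_add_le:
  assumes "0 \<le> u" "0 \<le> v"
  shows "\<phi> (u + v) \<le> \<phi> (2 * u) + \<phi> (2 * v)"
  using orlicz_mono[of "u + v" "2 * u"] orlicz_mono[of "u + v" "2 * v"]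
    orlicz_nonneg[of "2 * u"] orlicz_nonneg[of "2 * v"] assms
  by (cases "u \<le> v") auto

section \<open>Order properties of the modular and sums in the space\<close>

lemma ces_modular_le_mult:
  assumes "\<And>i. \<phi> (cesaro_mean x i) \<le> C * \<phi> (cesaro_mean y i)" "0 \<le> C"
  shows "ces_modular \<phi> x \<le> ennreal C * ces_modular \<phi> y"
proof -
  have "ces_modular \<phi> x \<le> (\<Sum>i. ennreal C * ennreal (\<phi> (cesaro_mean y i)))"
    unfolding ces_modular_def
    by (intro suminf_le)
      (use assms in \<open>auto simp: ennreal_mult[symmetric] orlicz_nonneg intro!: ennreal_leI\<close>)
  then show ?thesis
    by (simp add: ces_modular_def ennreal_suminf_cmult)
qed

lemma ces_modular_scale_mono:
  assumes "0 \<le> s" "s \<le> t"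
  shows "ces_modular \<phi> (\<lambda>i. s * x i) \<le> ces_modular \<phi> (\<lambda>i. t * x i)"
proof -
  have "ces_modular \<phi> (\<lambda>i. s * x i) \<le> ennreal 1 * ces_modular \<phi> (\<lambda>i. t * x i)"
    using assms by (intro ces_modular_le_mult)
      (auto simp: cesaro_mean_scale cesaro_mean_nonneg intro!: orlicz_mono mult_right_mono)
  then show ?thesis by simp
qed

lemma ces_modular_superadditive:
  assumes "\<And>i. 0 \<le> x i" "\<And>i. 0 \<le> y i"
  shows "ces_modular \<phi> x + ces_modular \<phi> y \<le> ces_modular \<phi> (\<lambda>i. x i + y i)"
proof -
  have "ces_modular \<phi> x + ces_modular \<phi> y
      = (\<Sum>i. ennreal (\<phi> (cesaro_mean x i)) + ennreal (\<phi> (cesaro_mean y i)))"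
    unfolding ces_modular_def by (intro suminf_add) auto
  also have "\<dots> \<le> ces_modular \<phi> (\<lambda>i. x i + y i)"
    unfolding ces_modular_def
    by (intro suminf_le)
      (auto simp: ennreal_plus[symmetric] orlicz_nonneg cesaro_mean_add assms cesaro_mean_nonneg
         simp del: ennreal_plus intro!: ennreal_leI orlicz_superadditive)
  finally show ?thesis .
qed

text \<open>The final norm estimate is applied to x + y, and a lower bound for its norm is
  meaningful only if the infimum runs over a nonempty set.\<close>

lemma ces_space_add:
  assumes "x \<in> ces_space \<phi>" "y \<in> ces_space \<phi>" "\<And>i. 0 \<le> x i" "\<And>i. 0 \<le> y i"
  shows "(\<lambda>i. x i + y i) \<in> ces_space \<phi>"
proof -
  obtain k l where k: "0 < k" "ces_modular \<phi> (\<lambda>i. k * x i) < \<infinity>"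
    and l: "0 < l" "ces_modular \<phi> (\<lambda>i. l * y i) < \<infinity>"
    using assms(1,2) by (auto simp: ces_space_def)
  \<comment> \<open>The minimum serves both sequences at once; the half used below absorbs the
    doubling in \<open>orlicz_add_le\<close>.\<close>
  define m where "m = min k l"
  have m: "0 < m" "m \<le> k" "m \<le> l" using k l by (auto simp: m_def)
  have "ces_modular \<phi> (\<lambda>i. m / 2 * (x i + y i))
      \<le> (\<Sum>i. ennreal (\<phi> (cesaro_mean (\<lambda>i. m * x i) i)) + ennreal (\<phi> (cesaro_mean (\<lambda>i. m * y i) i)))"
    unfolding ces_modular_def
  proof (intro suminf_le)
    fix i
    have "cesaro_mean (\<lambda>i. m / 2 * (x i + y i)) i = m / 2 * cesaro_mean x i + m / 2 * cesaro_mean y i"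
      using m by (simp only: cesaro_mean_scale cesaro_mean_add[OF assms(3,4)]) (simp add: distrib_left)
    then show "ennreal (\<phi> (cesaro_mean (\<lambda>i. m / 2 * (x i + y i)) i))
      \<le> ennreal (\<phi> (cesaro_mean (\<lambda>i. m * x i) i)) + ennreal (\<phi> (cesaro_mean (\<lambda>i. m * y i) i))"
      using orlicz_add_le[of "m / 2 * cesaro_mean x i" "m / 2 * cesaro_mean y i"] m
      by (simp add: cesaro_mean_scale cesaro_mean_nonneg orlicz_nonneg
          ennreal_plus[symmetric] ennreal_leI del: ennreal_plus)
  qed auto
  also have "\<dots> = ces_modular \<phi> (\<lambda>i. m * x i) + ces_modular \<phi> (\<lambda>i. m * y i)"
    unfolding ces_modular_def by (intro suminf_add[symmetric]) auto
  also have "\<dots> \<le> ces_modular \<phi> (\<lambda>i. k * x i) + ces_modular \<phi> (\<lambda>i. l * y i)"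
    using m by (intro add_mono ces_modular_scale_mono) auto
  also have "\<dots> < \<infinity>" using k l by simp
  finally show ?thesis
    unfolding ces_space_def using m by (auto intro!: exI[of _ "m / 2"])
qed

section \<open>The infimum in the norm, and boundedness of the means on the modular unit
  ball\<close>

lemma luxemburg_set_nonempty:
  assumes "x \<in> ces_space \<phi>"
  shows "\<exists>l>0. ces_modular \<phi> (\<lambda>i. x i / l) \<le> 1"
proof -
  obtain k where k: "0 < k" "ces_modular \<phi> (\<lambda>i. k * x i) < \<infinity>"
    using assms by (auto simp: ces_space_def)
  then obtain r where r: "0 \<le> r" "ces_modular \<phi> (\<lambda>i. k * x i) = ennreal r"
    by (cases "ces_modular \<phi> (\<lambda>i. k * x i)") auto
  \<comment> \<open>By convexity, shrinking by t \<le> 1 multiplies the modular by at most t. The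
    denominator 1 + r, instead of r, also covers r = 0 and keeps t at most 1.\<close>
  define t where "t = 1 / (1 + r)"
  have t: "0 < t" "t \<le> 1" "t * r \<le> 1" using r by (auto simp: t_def field_simps)
  have "ces_modular \<phi> (\<lambda>i. t * (k * x i)) \<le> ennreal t * ces_modular \<phi> (\<lambda>i. k * x i)"
    using t by (intro ces_modular_le_mult)
      (auto simp: cesaro_mean_scale[of t "\<lambda>i. k * x i"] intro!: orlicz_scale_le)
  also have "\<dots> \<le> 1"
    using t r by (simp add: ennreal_mult[symmetric])
  finally have "ces_modular \<phi> (\<lambda>i. x i / (1 / (t * k))) \<le> 1"
    by (simp add: mult_ac)
  then show ?thesis using t k by (intro exI[of _ "1 / (t * k)"]) auto
qed

text \<open>The strict inequality supplies an admissible k below l, and the modular of x / l is at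
  most that of x / k; whether the infimum is attained does not enter.\<close>

lemma ces_modular_le_1:
  assumes "x \<in> ces_space \<phi>" "luxemburg_norm \<phi> x < l"
  shows "ces_modular \<phi> (\<lambda>i. x i / l) \<le> 1"
proof -
  have "{l. l > 0 \<and> ces_modular \<phi> (\<lambda>i. x i / l) \<le> 1} \<noteq> {}"
    using luxemburg_set_nonempty[OF assms(1)] by auto
  from cInf_lessD[OF this] assms(2) obtain k
    where k: "0 < k" "k < l" "ces_modular \<phi> (\<lambda>i. x i / k) \<le> 1"
    by (auto simp: luxemburg_norm_def)
  have "ces_modular \<phi> (\<lambda>i. 1 / l * x i) \<le> ces_modular \<phi> (\<lambda>i. 1 / k * x i)"
    using k by (intro ces_modular_scale_mono) (auto simp: field_simps)
  then show ?thesis using k by simp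
qed

text \<open>Each term of the series is at most the whole modular, while \<phi> exceeds 1 beyond some
  point. That point depends only on \<phi>, so M is uniform in x and i.\<close>

lemma ces_modular_bounds_mean:
  "\<exists>M>0. \<forall>x. ces_modular \<phi> x \<le> 1 \<longrightarrow> (\<forall>i. cesaro_mean x i \<le> M)"
proof -
  from orlicz_at_top have "\<forall>\<^sub>F u in at_top. 2 \<le> \<phi> u"
    by (simp add: filterlim_at_top)
  then obtain N where N: "\<And>u. N \<le> u \<Longrightarrow> 2 \<le> \<phi> u"
    by (auto simp: eventually_at_top_linorder)
  define M where "M = max N 1"
  have "cesaro_mean x i \<le> M" if "ces_modular \<phi> x \<le> 1" for x i
  proof (rule ccontr)
    assume "\<not> cesaro_mean x i \<le> M"
    then have "2 \<le> \<phi> (cesaro_mean x i)" by (intro N) (auto simp: M_def)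
    moreover have "ennreal (\<phi> (cesaro_mean x i)) \<le> ces_modular \<phi> x"
      unfolding ces_modular_def
      using sum_le_suminf[of "\<lambda>i. ennreal (\<phi> (cesaro_mean x i))" "{i}"] by simp
    then have "ennreal (\<phi> (cesaro_mean x i)) \<le> 1"
      using that by (rule order_trans)
    then have "\<phi> (cesaro_mean x i) \<le> 1"
      by (simp only: ennreal_le_1)
    ultimately show False by simp
  qed
  then show ?thesis by (intro exI[of _ M]) (auto simp: M_def)
qed

section \<open>Consequences of the doubling condition\<close>

context
  assumes delta2: "delta2_at_0 \<phi>"
begin

text \<open>Beyond a, monotonicity bounds \<phi>(2u) by \<phi>(2M) and \<phi>(u) from below by
  \<phi>(a) > 0, so their ratio stays bounded up to M.\<close>

lemma delta2_on_interval:
  "\<exists>K\<ge>1. \<forall>u\<in>{0..M}. \<phi> (2 * u) \<le> K * \<phi> u"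
proof -
  obtain K a where a: "0 < K" "0 < a" "\<phi> a > 0"
    and K: "\<And>u. u \<in> {0..a} \<Longrightarrow> \<phi> (2 * u) \<le> K * \<phi> u"
    using delta2 by (auto simp: delta2_at_0_def)
  \<comment> \<open>The entry K serves [0, a], the quotient serves (a, M], and 1 gives the
    normalisation that makes products of such constants at least 1 again.\<close>
  define L where "L = max 1 (max K (\<phi> (2 * M) / \<phi> a))"
  have "\<phi> (2 * u) \<le> L * \<phi> u" if u: "u \<in> {0..M}" for u
  proof (cases "u \<le> a")
    case True
    then have "\<phi> (2 * u) \<le> K * \<phi> u" using u by (intro K) auto
    also have "\<dots> \<le> L * \<phi> u" by (intro mult_right_mono orlicz_nonneg) (auto simp: L_def)
    finally show ?thesis .
  next
    case False
    have "\<phi> (2 * u) \<le> \<phi> (2 * M)" using u by (intro orlicz_mono) auto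
    also have "\<dots> = \<phi> (2 * M) / \<phi> a * \<phi> a" using a by simp
    also have "\<dots> \<le> L * \<phi> u"
      using False a by (intro mult_mono orlicz_mono orlicz_nonneg) (auto simp: L_def)
    finally show ?thesis .
  qed
  then show ?thesis by (intro exI[of _ L]) (auto simp: L_def)
qed

lemma delta2_power_on_interval:
  "\<exists>K\<ge>1. \<forall>u\<in>{0..M}. \<phi> (2 ^ n * u) \<le> K * \<phi> u"
proof (induction n)
  case 0
  then show ?case by (intro exI[of _ 1]) auto
next
  case (Suc n)
  then obtain K where K: "1 \<le> K" "\<And>u. u \<in> {0..M} \<Longrightarrow> \<phi> (2 ^ n * u) \<le> K * \<phi> u"
    by auto
  \<comment> \<open>The last doubling acts on \<open>2 ^ n * u\<close>, so its constant has to be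
    taken on the enlarged interval.\<close>
  obtain L where L: "1 \<le> L" "\<And>u. u \<in> {0..2 ^ n * M} \<Longrightarrow> \<phi> (2 * u) \<le> L * \<phi> u"
    using delta2_on_interval[of "2 ^ n * M"] by auto
  have "\<phi> (2 ^ Suc n * u) \<le> L * K * \<phi> u" if "u \<in> {0..M}" for u
  proof -
    have "\<phi> (2 ^ Suc n * u) \<le> L * \<phi> (2 ^ n * u)"
      using L(2)[of "2 ^ n * u"] that by (auto simp: mult_ac)
    also have "\<dots> \<le> L * (K * \<phi> u)"
      using K that L by (intro mult_left_mono) auto
    finally show ?thesis by simp
  qed
  moreover have "1 \<le> L * K" using K L mult_mono[of 1 L 1 K] by simp
  ultimately show ?case by blast
qed

text \<open>A crude bound for one fixed factor c of any size, used to show that a small modular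
  forces a small norm.\<close>

lemma ces_modular_dilation:
  "\<exists>K>0. \<forall>x. ces_modular \<phi> x \<le> 1 \<longrightarrow> ces_modular \<phi> (\<lambda>i. c * x i) \<le> ennreal K * ces_modular \<phi> x"
proof -
  obtain M where M: "\<And>x i. ces_modular \<phi> x \<le> 1 \<Longrightarrow> cesaro_mean x i \<le> M"
    using ces_modular_bounds_mean by blast
  obtain n where n: "\<bar>c\<bar> < 2 ^ n"
    using real_arch_pow[of 2 "\<bar>c\<bar>"] by auto
  obtain K where K: "1 \<le> K" "\<And>u. u \<in> {0..M} \<Longrightarrow> \<phi> (2 ^ n * u) \<le> K * \<phi> u"
    using delta2_power_on_interval[of M n] by blast
  have "ces_modular \<phi> (\<lambda>i. c * x i) \<le> ennreal K * ces_modular \<phi> x" if "ces_modular \<phi> x \<le> 1" for x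
  proof (rule ces_modular_le_mult)
    fix i
    have "\<phi> (cesaro_mean (\<lambda>i. c * x i) i) \<le> \<phi> (2 ^ n * cesaro_mean x i)"
      using n by (auto simp: cesaro_mean_scale cesaro_mean_nonneg intro!: orlicz_mono mult_right_mono)
    also have "\<dots> \<le> K * \<phi> (cesaro_mean x i)"
      using M[OF that] by (intro K) (auto simp: cesaro_mean_nonneg)
    finally show "\<phi> (cesaro_mean (\<lambda>i. c * x i) i) \<le> K * \<phi> (cesaro_mean x i)" .
  qed (use K in simp)
  then show ?thesis using K(1) by (intro exI[of _ K]) auto
qed

text \<open>Unlike the crude bound, the factor here tends to 1 with t, uniformly in x: the point (1
  + t)u lies on the segment from u to 2u with weight t at 2u, so doubling costs only the share
  t.\<close>

lemma ces_modular_small_dilation: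
  "\<exists>K>0. \<forall>x t. ces_modular \<phi> x \<le> 1 \<longrightarrow> 0 \<le> t \<longrightarrow> t \<le> 1 \<longrightarrow>
     ces_modular \<phi> (\<lambda>i. (1 + t) * x i) \<le> ennreal (1 + t * K) * ces_modular \<phi> x"
proof -
  obtain M where M: "\<And>x i. ces_modular \<phi> x \<le> 1 \<Longrightarrow> cesaro_mean x i \<le> M"
    using ces_modular_bounds_mean by blast
  obtain K where K: "1 \<le> K" "\<And>u. u \<in> {0..M} \<Longrightarrow> \<phi> (2 * u) \<le> K * \<phi> u"
    using delta2_on_interval[of M] by blast
  have "ces_modular \<phi> (\<lambda>i. (1 + t) * x i) \<le> ennreal (1 + t * K) * ces_modular \<phi> x"
    if x: "ces_modular \<phi> x \<le> 1" and t: "0 \<le> t" "t \<le> 1" for x t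
  proof (rule ces_modular_le_mult)
    fix i
    let ?u = "cesaro_mean x i"
    have "\<phi> ((1 + t) * ?u) = \<phi> ((1 - t) * ?u + t * (2 * ?u))"
      by (simp add: algebra_simps)
    also have "\<dots> \<le> (1 - t) * \<phi> ?u + t * \<phi> (2 * ?u)"
      using convex_onD[OF orlicz_convex, of t ?u "2 * ?u"] t by simp
    \<comment> \<open>The weight 1 - t is enlarged to 1, which leaves a constant linear in
      t.\<close>
    also have "\<dots> \<le> 1 * \<phi> ?u + t * (K * \<phi> ?u)"
      using M[OF x] t
      by (intro add_mono mult_right_mono mult_left_mono orlicz_nonneg K) (auto simp: cesaro_mean_nonneg)
    also have "\<dots> = (1 + t * K) * \<phi> ?u"
      by (simp add: distrib_right)
    finally show "\<phi> (cesaro_mean (\<lambda>i. (1 + t) * x i) i) \<le> (1 + t * K) * \<phi> ?u"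
      using t by (simp add: cesaro_mean_scale del: mult_cancel_right)
  qed (use K t in simp)
  then show ?thesis using K(1) by (intro exI[of _ K]) auto
qed

text \<open>A modular below 1 leaves room for a slight dilation that keeps it at most 1, which
  pushes the norm strictly below 1.\<close>

lemma ces_modular_ge_1:
  assumes "1 \<le> luxemburg_norm \<phi> x"
  shows "1 \<le> ces_modular \<phi> x"
proof (rule ccontr)
  assume "\<not> 1 \<le> ces_modular \<phi> x"
  then have less: "ces_modular \<phi> x < 1" by simp
  then obtain r where r: "0 \<le> r" "ces_modular \<phi> x = ennreal r" "r < 1"
    by (cases "ces_modular \<phi> x") (auto simp: ennreal_less_one_iff)
  obtain K where K: "0 < K" "\<And>t. 0 \<le> t \<Longrightarrow> t \<le> 1 \<Longrightarrow>
      ces_modular \<phi> (\<lambda>i. (1 + t) * x i) \<le> ennreal (1 + t * K) * ces_modular \<phi> x"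
    using ces_modular_small_dilation less by (meson less_imp_le)
  \<comment> \<open>This gives tK \<le> 1 - r, hence (1 + tK) r \<le> r + (1 - r) = 1 because r <
    1.\<close>
  define t where "t = min 1 ((1 - r) / K)"
  have t: "0 < t" "t \<le> 1" using r K by (auto simp: t_def)
  have "t * K \<le> (1 - r) / K * K" using K by (intro mult_right_mono) (auto simp: t_def)
  then have tK: "t * K \<le> 1 - r" using K by simp
  have "(1 + t * K) * r = r + (t * K) * r" by (simp add: algebra_simps)
  also have "\<dots> \<le> r + (1 - r) * 1" using tK r by (intro add_left_mono mult_mono) auto
  finally have "(1 + t * K) * r \<le> 1" by simp
  then have "ennreal (1 + t * K) * ces_modular \<phi> x \<le> 1"
    using r t K(1) by (simp add: ennreal_mult[symmetric] del: ennreal_plus)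
  with K(2)[of t] t have "ces_modular \<phi> (\<lambda>i. (1 + t) * x i) \<le> 1"
    by (meson less_imp_le order_trans)
  then have "ces_modular \<phi> (\<lambda>i. x i / (1 / (1 + t))) \<le> 1"
    by (simp add: mult_ac)
  then have "luxemburg_norm \<phi> x \<le> 1 / (1 + t)"
    using t by (intro luxemburg_norm_le) auto
  also have "\<dots> < 1" using t by simp
  finally show False using assms by simp
qed

lemma ces_modular_bounded_below:
  assumes "0 < \<epsilon>"
  shows "\<exists>\<eta>>0. \<forall>y. \<epsilon> \<le> luxemburg_norm \<phi> y \<longrightarrow> ennreal \<eta> \<le> ces_modular \<phi> y"
proof -
  obtain K where K: "0 < K" "\<And>y. ces_modular \<phi> y \<le> 1 \<Longrightarrow>
      ces_modular \<phi> (\<lambda>i. 2 / \<epsilon> * y i) \<le> ennreal K * ces_modular \<phi> y"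
    \<comment> \<open>The factor 2 / \<epsilon> leads to a norm of at most \<epsilon> / 2, strictly
      below \<epsilon>.\<close>
    using ces_modular_dilation[of "2 / \<epsilon>"] by blast
  \<comment> \<open>The bound 1 makes the dilation estimate applicable to y, and 1 / K brings the
    dilated modular down to at most 1.\<close>
  define \<eta> where "\<eta> = min 1 (1 / K)"
  have \<eta>: "0 < \<eta>" "\<eta> \<le> 1" "K * \<eta> \<le> 1"
    using K by (auto simp: \<eta>_def min_def field_simps)
  have "ennreal \<eta> \<le> ces_modular \<phi> y" if y: "\<epsilon> \<le> luxemburg_norm \<phi> y" for y
  proof (rule ccontr)
    assume "\<not> ennreal \<eta> \<le> ces_modular \<phi> y"
    then have less: "ces_modular \<phi> y < ennreal \<eta>" by simp
    also have "\<dots> \<le> 1" using \<eta> by simp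
    finally have "ces_modular \<phi> (\<lambda>i. 2 / \<epsilon> * y i) \<le> ennreal K * ces_modular \<phi> y"
      by (intro K) simp
    also have "\<dots> \<le> ennreal K * ennreal \<eta>"
      using less by (intro mult_left_mono) auto
    also have "\<dots> \<le> 1" using K \<eta> by (simp add: ennreal_mult[symmetric])
    finally have "luxemburg_norm \<phi> y \<le> \<epsilon> / 2"
      using assms by (intro luxemburg_norm_le) (auto simp: mult_ac)
    then show False using y assms by simp
  qed
  then show ?thesis using \<eta> by blast
qed

text \<open>If the norm were below 1 + \<delta>, then z / (1 + \<delta>) would have modular at most
  1, and dilating back would give z a modular of at most 1 + \<delta> K, less than 1 +
  \<eta>.\<close>

lemma luxemburg_norm_bounded_below:
  assumes "0 < \<eta>"
  shows "\<exists>\<delta>>0. \<forall>z\<in>ces_space \<phi>. ennreal (1 + \<eta>) \<le> ces_modular \<phi> z \<longrightarrow> 1 + \<delta> \<le> luxemburg_norm \<phi> z"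
proof -
  obtain K where K: "0 < K" "\<And>x t. ces_modular \<phi> x \<le> 1 \<Longrightarrow> 0 \<le> t \<Longrightarrow> t \<le> 1 \<Longrightarrow>
      ces_modular \<phi> (\<lambda>i. (1 + t) * x i) \<le> ennreal (1 + t * K) * ces_modular \<phi> x"
    using ces_modular_small_dilation by blast
  \<comment> \<open>The 2 in the denominator makes \<delta> K < \<eta> strict, as the contradiction
    requires.\<close>
  define \<delta> where "\<delta> = min 1 (\<eta> / (2 * K))"
  have \<delta>: "0 < \<delta>" "\<delta> \<le> 1" using K assms by (auto simp: \<delta>_def)
  have "\<delta> * K \<le> \<eta> / (2 * K) * K" using K by (intro mult_right_mono) (auto simp: \<delta>_def)
  then have \<delta>K: "\<delta> * K < \<eta>" using K assms by simp
  have "1 + \<delta> \<le> luxemburg_norm \<phi> z"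
    if z: "z \<in> ces_space \<phi>" "ennreal (1 + \<eta>) \<le> ces_modular \<phi> z" for z
  proof (rule ccontr)
    assume "\<not> 1 + \<delta> \<le> luxemburg_norm \<phi> z"
    then have le: "ces_modular \<phi> (\<lambda>i. z i / (1 + \<delta>)) \<le> 1"
      using z by (intro ces_modular_le_1) auto
    have "ces_modular \<phi> z = ces_modular \<phi> (\<lambda>i. (1 + \<delta>) * (z i / (1 + \<delta>)))"
      using \<delta> by simp
    also have "\<dots> \<le> ennreal (1 + \<delta> * K) * ces_modular \<phi> (\<lambda>i. z i / (1 + \<delta>))"
      using \<delta> by (intro K le) auto
    also have "\<dots> \<le> ennreal (1 + \<delta> * K) * 1"
      using le by (intro mult_left_mono) auto
    also have "\<dots> < ennreal (1 + \<eta>)"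
      using \<delta> K \<delta>K by (simp add: ennreal_less_iff del: ennreal_plus)
    finally show False using z by simp
  qed
  then show ?thesis using \<delta> by blast
qed

end

end

theorem theorem2p6:
  fixes \<phi> :: "real \<Rightarrow> real"
  assumes "orlicz_function \<phi>"
    and "ces_space \<phi> \<noteq> {\<lambda>i. 0}"
    and "delta2_at_0 \<phi>"
  shows "uniformly_monotone (ces_space \<phi>) (luxemburg_norm \<phi>)"
  unfolding uniformly_monotone_def
proof (intro allI impI)
  fix \<epsilon> :: real
  assume "0 < \<epsilon>"
  then obtain \<eta> where \<eta>: "0 < \<eta>"
    "\<And>y. \<epsilon> \<le> luxemburg_norm \<phi> y \<Longrightarrow> ennreal \<eta> \<le> ces_modular \<phi> y"
    using ces_modular_bounded_below[OF assms(1,3)] by blast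
  obtain \<delta> where \<delta>: "0 < \<delta>"
    "\<And>z. z \<in> ces_space \<phi> \<Longrightarrow> ennreal (1 + \<eta>) \<le> ces_modular \<phi> z \<Longrightarrow> 1 + \<delta> \<le> luxemburg_norm \<phi> z"
    using luxemburg_norm_bounded_below[OF assms(1,3) \<eta>(1)] by blast
  have "1 + \<delta> \<le> luxemburg_norm \<phi> (\<lambda>i. x i + y i)"
    if xy: "x \<in> ces_space \<phi>" "y \<in> ces_space \<phi>" "\<forall>i. 0 \<le> x i" "\<forall>i. 0 \<le> y i"
      and N: "luxemburg_norm \<phi> x = 1" "luxemburg_norm \<phi> y \<ge> \<epsilon>" for x y
  proof (rule \<delta>(2))
    show "(\<lambda>i. x i + y i) \<in> ces_space \<phi>"
      using xy by (intro ces_space_add assms) auto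
    \<comment> \<open>The norm condition on x contributes the 1, the one on y the \<eta>;
      superadditivity joins them.\<close>
    have "ennreal (1 + \<eta>) = 1 + ennreal \<eta>" using \<eta> by simp
    also have "\<dots> \<le> ces_modular \<phi> x + ces_modular \<phi> y"
      using ces_modular_ge_1[OF assms(1,3), of x] \<eta>(2)[of y] N by (intro add_mono) auto
    also have "\<dots> \<le> ces_modular \<phi> (\<lambda>i. x i + y i)"
      using xy by (intro ces_modular_superadditive assms) auto
    finally show "ennreal (1 + \<eta>) \<le> ces_modular \<phi> (\<lambda>i. x i + y i)" .
  qed
  then show "\<exists>\<delta>>0. \<forall>x\<in>ces_space \<phi>. \<forall>y\<in>ces_space \<phi>. (\<forall>i. 0 \<le> x i) \<longrightarrow> (\<forall>i. 0 \<le> y i) \<longrightarrow>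
      luxemburg_norm \<phi> x = 1 \<longrightarrow> \<epsilon> \<le> luxemburg_norm \<phi> y \<longrightarrow>
      1 + \<delta> \<le> luxemburg_norm \<phi> (\<lambda>i. x i + y i)"
    using \<delta>(1) by blast
qed

end
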